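(* Let $G$ be a connected graph. Then $(G,\alpha)$ satisfies the Universal Difference Property for every commutative ring $R$ with unity and every edge-labeling $\alpha$ of $G$ over $R$ if and only if $G$ is a tree or a cycle.
   Context: An edge-labeling assigns to each edge an ideal of $R$. A spline on $(G,\alpha)$ is a function $\rho:V(G)\to R$ with $\rho(u)-\rho(v)\in\alpha(uv)$ for every edge $uv$. A path has no repeated vertices; for a path $P$, $\alpha(P)$ is the sum of the labels of its edges. $(G,\alpha)$ satisfies the Universal Difference Property if for every pair of vertices $u,w$ and every $x\in\bigcap_P\alpha(P)$ (over all paths $P$ from $u$ to $w$ in $G$) there is a spline $\rho$ with $\rho(u)-\rho(w)=x$. *)

theory Defs
  imports "HOL-Algebra.Ideal"
begin

text \<open>A simple graph is a vertex set together with a set of two-element subsets of it;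
  neither set is required to be finite.\<close>

definition simple_graph :: "'v set \<Rightarrow> 'v set set \<Rightarrow> bool" where
  "simple_graph V E \<longleftrightarrow> E \<subseteq> {{u, v} | u v. u \<in> V \<and> v \<in> V \<and> u \<noteq> v}"

fun walk_edges :: "'v list \<Rightarrow> 'v set list" where
  "walk_edges (u # v # p) = {u, v} # walk_edges (v # p)"
| "walk_edges p = []"

definition graph_path :: "'v set \<Rightarrow> 'v set set \<Rightarrow> 'v \<Rightarrow> 'v list \<Rightarrow> 'v \<Rightarrow> bool" where
  "graph_path V E u p w \<longleftrightarrow>
     p \<noteq> [] \<and> hd p = u \<and> last p = w \<and> distinct p \<and> set p \<subseteq> V \<and> set (walk_edges p) \<subseteq> E"

definition graph_connected :: "'v set \<Rightarrow> 'v set set \<Rightarrow> bool" where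
  "graph_connected V E \<longleftrightarrow> V \<noteq> {} \<and> (\<forall>u\<in>V. \<forall>w\<in>V. \<exists>p. graph_path V E u p w)"

text \<open>A cycle is the list of its distinct vertices in cyclic order; the first vertex is not
  repeated at the end.\<close>

definition cycle_edges :: "'v list \<Rightarrow> 'v set set" where
  "cycle_edges c = set (walk_edges (c @ [hd c]))"

definition graph_cycle :: "'v set \<Rightarrow> 'v set set \<Rightarrow> 'v list \<Rightarrow> bool" where
  "graph_cycle V E c \<longleftrightarrow> length c \<ge> 3 \<and> distinct c \<and> set c \<subseteq> V \<and> cycle_edges c \<subseteq> E"

definition is_tree :: "'v set \<Rightarrow> 'v set set \<Rightarrow> bool" where
  "is_tree V E \<longleftrightarrow> graph_connected V E \<and> (\<nexists>c. graph_cycle V E c)"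

definition is_cycle :: "'v set \<Rightarrow> 'v set set \<Rightarrow> bool" where
  "is_cycle V E \<longleftrightarrow> (\<exists>c. graph_cycle V E c \<and> set c = V \<and> cycle_edges c = E)"

definition edge_labeling :: "('r, 'm) ring_scheme \<Rightarrow> 'v set set \<Rightarrow> ('v set \<Rightarrow> 'r set) \<Rightarrow> bool" where
  "edge_labeling R E \<alpha> \<longleftrightarrow> (\<forall>e\<in>E. ideal (\<alpha> e) R)"

definition spline ::
  "('r, 'm) ring_scheme \<Rightarrow> 'v set \<Rightarrow> 'v set set \<Rightarrow> ('v set \<Rightarrow> 'r set) \<Rightarrow> ('v \<Rightarrow> 'r) \<Rightarrow> bool" where
  "spline R V E \<alpha> \<rho> \<longleftrightarrow>
     \<rho> \<in> V \<rightarrow> carrier R \<and> (\<forall>u v. {u, v} \<in> E \<longrightarrow> \<rho> u \<ominus>\<^bsub>R\<^esub> \<rho> v \<in> \<alpha> {u, v})"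

definition path_label :: "('r, 'm) ring_scheme \<Rightarrow> ('v set \<Rightarrow> 'r set) \<Rightarrow> 'v list \<Rightarrow> 'r set" where
  "path_label R \<alpha> p = foldr (\<lambda>e I. \<alpha> e <+>\<^bsub>R\<^esub> I) (walk_edges p) {\<zero>\<^bsub>R\<^esub>}"

definition universal_difference_property ::
  "('r, 'm) ring_scheme \<Rightarrow> 'v set \<Rightarrow> 'v set set \<Rightarrow> ('v set \<Rightarrow> 'r set) \<Rightarrow> bool" where
  "universal_difference_property R V E \<alpha> \<longleftrightarrow>
     (\<forall>u\<in>V. \<forall>w\<in>V. \<forall>x \<in> carrier R \<inter> (\<Inter>p\<in>{p. graph_path V E u p w}. path_label R \<alpha> p).
        \<exists>\<rho>. spline R V E \<alpha> \<rho> \<and> \<rho> u \<ominus>\<^bsub>R\<^esub> \<rho> w = x)"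

end

theory Submission
  imports Defs
begin

text \<open>In a tree every edge is a bridge, so a decomposition of the prescribed difference along the
  unique path is realised edge by edge; on a cycle the two paths between two vertices meet only in
  their ends, so the functions built along them glue. Any other connected graph contains a cycle
  with an edge \<open>da\<close> leaving it. Label \<open>da\<close> by \<open>I\<close>, the two cycle edges at \<open>a\<close> by \<open>J\<close> and \<open>K\<close>, the
  rest of the cycle by \<open>0\<close> and all other edges by \<open>R\<close>. For \<open>b\<close> a neighbour of \<open>a\<close> on the cycle,
  every path from \<open>d\<close> to \<open>b\<close> has a label containing \<open>I + J\<close> or \<open>I + K\<close>, while splines only realise
  differences in \<open>I + (J \<inter> K)\<close>, so ideals violating distributivity give a counterexample.\<close>

section \<open>Walks and cycles\<close>

text \<open>The vertex \<open>y\<close> stays in both halves, so no edge is lost at the cut.\<close>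

lemma walk_edges_append:
  "set (walk_edges (xs @ y # ys)) = set (walk_edges (xs @ [y])) \<union> set (walk_edges (y # ys))"
proof (induction xs)
  case (Cons x xs)
  then show ?case by (cases xs) auto
qed simp

lemma walk_edges_rev: "set (walk_edges (rev p)) = set (walk_edges p)"
proof (induction p rule: walk_edges.induct)
  case (1 u v p)
  have "set (walk_edges (rev (u # v # p))) = set (walk_edges (rev (v # p))) \<union> {{v, u}}"
    using walk_edges_append[of "rev p" v "[u]"] by simp
  with 1 show ?case by auto
qed auto

lemma walk_edge_subset: "e \<in> set (walk_edges p) \<Longrightarrow> e \<subseteq> set p"
  by (induction p rule: walk_edges.induct) auto

text \<open>Two vertices of a cycle divide it into two arcs. Reversing \<open>B\<close> makes both
  arcs run from \<open>s\<close> to \<open>t\<close>, which serves chords as well as pairs of paths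
  with common ends.\<close>

lemma cycle_edges_split:
  "cycle_edges (s # A @ t # B) = set (walk_edges (s # A @ [t])) \<union> set (walk_edges (s # rev B @ [t]))"
proof -
  have "cycle_edges (s # A @ t # B) = set (walk_edges ((s # A) @ t # (B @ [s])))"
    by (simp add: cycle_edges_def)
  also have "\<dots> = set (walk_edges (s # A @ [t])) \<union> set (walk_edges (rev (s # rev B @ [t])))"
    by (subst walk_edges_append) simp
  finally show ?thesis
    by (simp only: walk_edges_rev)
qed

text \<open>Allows any vertex of a cycle to be taken as the head of its list: moving a prefix to the
  back only changes which edge closes the list.\<close>

lemma graph_cycle_rotate:
  assumes "graph_cycle V E c" "s \<in> set c"
  obtains q where "graph_cycle V E (s # q)" "set (s # q) = set c" "cycle_edges (s # q) = cycle_edges c"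
proof -
  obtain X Y where c: "c = X @ s # Y"
    using assms(2) by (auto simp: in_set_conv_decomp)
  have "cycle_edges (s # Y @ X) = cycle_edges c"
  proof (cases X)
    case (Cons x X')
    have "cycle_edges c = set (walk_edges (X @ s # (Y @ [x])))"
      by (simp add: c Cons cycle_edges_def)
    moreover have "cycle_edges (s # Y @ X) = set (walk_edges ((s # Y) @ x # (X' @ [s])))"
      by (simp add: Cons cycle_edges_def)
    ultimately show ?thesis
      using walk_edges_append[of X s "Y @ [x]"] walk_edges_append[of "s # Y" x "X' @ [s]"]
      by (auto simp: Cons)
  qed (simp add: c)
  then show ?thesis
    using that[of "Y @ X"] assms(1) by (auto simp: graph_cycle_def c)
qed

text \<open>A path is extended edge by edge. If the next vertex already occurs on it, the path is
  cut off there instead, which keeps the vertices distinct.\<close>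

lemma rtrancl_imp_graph_path:
  assumes "(v, w) \<in> {(a, b). {a, b} \<in> F}\<^sup>*" "v \<in> V" "\<And>e. e \<in> F \<Longrightarrow> e \<subseteq> V"
  shows "\<exists>p. graph_path V F v p w"
  using assms(1)
proof (induction rule: rtrancl_induct)
  case base
  then show ?case
    using assms(2) by (intro exI[of _ "[v]"]) (simp add: graph_path_def)
next
  case (step y z)
  then obtain p where p: "graph_path V F v p y" and yz: "{y, z} \<in> F" by auto
  show ?case
  proof (cases "z \<in> set p")
    case True
    then obtain X Y where "p = X @ z # Y"
      by (auto simp: in_set_conv_decomp)
    then have "graph_path V F v (X @ [z]) z"
      using p walk_edges_append[of X z Y] by (cases X) (auto simp: graph_path_def)
    then show ?thesis by blast
  next
    case False
    obtain X where X: "p = X @ [y]"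
      using p append_butlast_last_id[of p] unfolding graph_path_def by metis
    have "graph_path V F v (p @ [z]) z"
      using p False yz assms(3)[OF yz] walk_edges_append[of X y "[z]"]
      by (cases X) (auto simp: graph_path_def X)
    then show ?thesis by blast
  qed
qed

lemma walk_imp_rtrancl:
  "\<lbrakk>p \<noteq> []; set (walk_edges p) \<subseteq> F\<rbrakk> \<Longrightarrow> (hd p, last p) \<in> {(a, b). {a, b} \<in> F}\<^sup>*"
proof (induction p rule: walk_edges.induct)
  case (1 u v p)
  then have "(u, v) \<in> {(a, b). {a, b} \<in> F}" "(v, last (v # p)) \<in> {(a, b). {a, b} \<in> F}\<^sup>*"
    by auto
  then show ?case
    by (auto intro: converse_rtrancl_into_rtrancl)
qed auto

lemma crossing_walk_edge:
  "\<lbrakk>p \<noteq> []; hd p \<in> S; last p \<notin> S\<rbrakk> \<Longrightarrow> \<exists>s t. {s, t} \<in> set (walk_edges p) \<and> s \<in> S \<and> t \<notin> S"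
proof (induction p rule: walk_edges.induct)
  case (1 u v p)
  then show ?case by (cases "v \<in> S") auto
qed auto

section \<open>Bridges, and edges leaving a cycle\<close>

lemma simple_graph_edgeD:
  assumes "simple_graph V E" "{u, v} \<in> E"
  shows "u \<in> V" "v \<in> V" "u \<noteq> v"
proof -
  obtain a b where "{u, v} = {a, b}" "a \<in> V" "b \<in> V" "a \<noteq> b"
    using assms unfolding simple_graph_def by blast
  then show "u \<in> V" "v \<in> V" "u \<noteq> v"
    by (auto simp: doubleton_eq_iff)
qed

text \<open>Otherwise a path from \<open>v\<close> to \<open>u\<close> avoiding the edge would be
  closed by that edge to a cycle.\<close>

lemma acyclic_edge_is_bridge:
  assumes "simple_graph V E" "\<nexists>c. graph_cycle V E c" "{u, v} \<in> E"
  shows "(v, u) \<notin> {(a, b). {a, b} \<in> E - {{u, v}}}\<^sup>*"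
proof
  assume "(v, u) \<in> {(a, b). {a, b} \<in> E - {{u, v}}}\<^sup>*"
  moreover have "v \<in> V" "u \<noteq> v"
    using simple_graph_edgeD[OF assms(1,3)] by auto
  moreover have "e \<subseteq> V" if "e \<in> E - {{u, v}}" for e
    using that assms(1) unfolding simple_graph_def by blast
  ultimately obtain p where p: "graph_path V (E - {{u, v}}) v p u"
    using rtrancl_imp_graph_path by metis
  obtain x q where q: "p = v # x # q"
    using p \<open>u \<noteq> v\<close> by (cases p rule: walk_edges.cases) (auto simp: graph_path_def)
  \<comment> \<open>A path with only two vertices would consist of the removed edge itself; so there
    are at least three, as a cycle requires.\<close>
  have "q \<noteq> []"
    using p by (auto simp: graph_path_def q insert_commute)
  moreover have "cycle_edges p = set (walk_edges p) \<union> {{u, v}}"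
  proof -
    have "p = butlast p @ [u]"
      using p append_butlast_last_id[of p] unfolding graph_path_def by metis
    then have "cycle_edges p = set (walk_edges (butlast p @ u # [v]))"
      unfolding cycle_edges_def using p
      by (metis append.assoc append_Cons append_Nil graph_path_def)
    also have "\<dots> = set (walk_edges (butlast p @ [u])) \<union> {{u, v}}"
      by (subst walk_edges_append) simp
    finally show ?thesis
      using \<open>p = butlast p @ [u]\<close> by simp
  qed
  ultimately have "graph_cycle V E p"
    using p assms(3) by (cases q) (auto simp: graph_cycle_def graph_path_def q)
  then show False
    using assms(2) by blast
qed

text \<open>If the cycle is spanning, a chord cuts off a shorter cycle that the rest of the
  original cycle leaves.\<close>

lemma not_cycle_imp_pendant_edge:
  assumes "simple_graph V E" "graph_connected V E" "graph_cycle V E c" "\<not> is_cycle V E"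
  obtains a q d where "graph_cycle V E (a # q)" "d \<in> V" "d \<notin> set (a # q)" "{d, a} \<in> E"
proof (cases "set c = V")
  case False
  then obtain w where w: "w \<in> V" "w \<notin> set c"
    using assms(3) unfolding graph_cycle_def by blast
  have "c \<noteq> []" "hd c \<in> V"
    using assms(3) by (cases c; auto simp: graph_cycle_def)+
  then obtain p where p: "graph_path V E (hd c) p w"
    using assms(2) w unfolding graph_connected_def by blast
  \<comment> \<open>By connectedness some path runs from the cycle to \<open>w\<close>; one of its
    edges leaves the cycle.\<close>
  then obtain s t where st: "{s, t} \<in> E" "s \<in> set c" "t \<notin> set c"
    using crossing_walk_edge[of p "set c"] w \<open>c \<noteq> []\<close> unfolding graph_path_def by fastforce
  obtain q where "graph_cycle V E (s # q)" "set (s # q) = set c"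
    using graph_cycle_rotate[OF assms(3) st(2)] by metis
  then show ?thesis
    using that st simple_graph_edgeD[OF assms(1) st(1)] by (metis insert_commute)
next
  case True
  then have "cycle_edges c \<noteq> E"
    using assms(3,4) unfolding is_cycle_def by blast
  then obtain e where "e \<in> E" "e \<notin> cycle_edges c"
    using assms(3) unfolding graph_cycle_def by blast
  then obtain s t where st: "{s, t} \<in> E" "{s, t} \<notin> cycle_edges c" "s \<in> V" "t \<in> V" "s \<noteq> t"
    using assms(1) unfolding simple_graph_def by blast
  obtain q where q: "graph_cycle V E (s # q)" "set (s # q) = set c" "cycle_edges (s # q) = cycle_edges c"
    using graph_cycle_rotate[OF assms(3)] st(3) True by metis
  then have "t \<in> set q"
    using st True by auto
  then obtain A B where AB: "q = A @ t # B"
    by (auto simp: in_set_conv_decomp)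
  have ce: "cycle_edges c = set (walk_edges (s # A @ [t])) \<union> set (walk_edges (s # rev B @ [t]))"
    using q(3) unfolding AB by (simp only: cycle_edges_split)
  \<comment> \<open>An empty arc would make the chord an edge of the cycle. Hence \<open>s\<close>
    has a neighbour \<open>d\<close> on the second arc, different from \<open>t\<close>.\<close>
  have "A \<noteq> []" "B \<noteq> []"
    using st(2) unfolding ce by auto
  then obtain B' d where B: "B = B' @ [d]"
    by (metis rev_exhaust)
  have ceE: "cycle_edges c \<subseteq> E"
    using assms(3) by (simp add: graph_cycle_def)
  \<comment> \<open>With an empty second arc, the splitting lemma describes the first arc closed by
    the chord.\<close>
  have "cycle_edges (s # A @ [t]) = set (walk_edges (s # A @ [t])) \<union> {{s, t}}"
    using cycle_edges_split[of s A t "[]"] by simp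
  then have "graph_cycle V E (s # A @ [t])"
    using q(1) st(1) ce ceE \<open>A \<noteq> []\<close> by (cases A) (auto simp: graph_cycle_def AB)
  moreover have "{s, d} \<in> set (walk_edges (s # rev B @ [t]))"
    by (simp add: B)
  then have "{d, s} \<in> E"
    using ce ceE by (auto simp: insert_commute)
  moreover have "d \<in> V" "d \<notin> set (s # A @ [t])"
    using q(1) by (auto simp: graph_cycle_def AB B)
  ultimately show ?thesis
    using that by blast
qed

section \<open>Splines on trees and cycles\<close>

lemma path_label_single [simp]: "path_label R \<alpha> [v] = {\<zero>\<^bsub>R\<^esub>}"
  by (simp add: path_label_def)

lemma path_label_Cons [simp]:
  "path_label R \<alpha> (u # v # p) = \<alpha> {u, v} <+>\<^bsub>R\<^esub> path_label R \<alpha> (v # p)"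
  by (simp add: path_label_def)

context cring
begin

lemma ideal_minus_commute:
  assumes "ideal I R" "a \<in> carrier R" "b \<in> carrier R" "a \<ominus> b \<in> I"
  shows "b \<ominus> a \<in> I"
proof -
  interpret I: ideal I R by fact
  have "b \<ominus> a = \<ominus> (a \<ominus> b)"
    using assms by algebra
  then show ?thesis
    using assms(4) by simp
qed

lemma zero_in_path_label:
  "\<lbrakk>p \<noteq> []; \<And>e. e \<in> set (walk_edges p) \<Longrightarrow> ideal (\<alpha> e) R\<rbrakk> \<Longrightarrow> \<zero> \<in> path_label R \<alpha> p"
proof (induction p rule: walk_edges.induct)
  case (1 u v p)
  then have "ideal (\<alpha> {u, v}) R" "\<zero> \<in> path_label R \<alpha> (v # p)"
    by auto
  then have "\<zero> \<in> \<alpha> {u, v}"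
    using additive_subgroup.zero_closed ideal.axioms(1) by blast
  with \<open>\<zero> \<in> path_label R \<alpha> (v # p)\<close> show ?case
    by (force simp: set_add_def')
qed auto

lemma path_label_subset_carrier:
  "\<lbrakk>p \<noteq> []; \<And>e. e \<in> set (walk_edges p) \<Longrightarrow> ideal (\<alpha> e) R\<rbrakk> \<Longrightarrow> path_label R \<alpha> p \<subseteq> carrier R"
proof (induction p rule: walk_edges.induct)
  case (1 u v p)
  then have "ideal (\<alpha> {u, v}) R" "path_label R \<alpha> (v # p) \<subseteq> carrier R"
    by auto
  then show ?case
    using ideal.Icarr by (fastforce simp: set_add_def')
qed auto

text \<open>Decompose \<open>x\<close> into one summand per edge and give each vertex the sum of the
  summands still ahead of it. As vertices are distinct, setting the value at a new head does not
  disturb the tail. The fixed end values \<open>x\<close> and zero allow two such functions to be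
  glued.\<close>

lemma spline_along_path:
  assumes "p \<noteq> []" "distinct p" "\<And>e. e \<in> set (walk_edges p) \<Longrightarrow> ideal (\<alpha> e) R"
    and "x \<in> path_label R \<alpha> p"
  shows "\<exists>f. (\<forall>v. f v \<in> carrier R) \<and> f (hd p) = x \<and> f (last p) = \<zero> \<and>
    (\<forall>s t. {s, t} \<in> set (walk_edges p) \<longrightarrow> f s \<ominus> f t \<in> \<alpha> {s, t})"
  using assms
proof (induction p arbitrary: x rule: walk_edges.induct)
  case (1 u v p)
  obtain y z where yz: "y \<in> \<alpha> {u, v}" "z \<in> path_label R \<alpha> (v # p)" "x = y \<oplus> z"
    using "1.prems"(4) by (auto simp: set_add_def')
  have id: "ideal (\<alpha> {u, v}) R"
    using "1.prems"(3) by simp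
  have [simp]: "y \<in> carrier R"
    using id yz(1) ideal.Icarr by metis
  have [simp]: "z \<in> carrier R"
    using path_label_subset_carrier[of "v # p" \<alpha>] "1.prems"(3) yz(2) by auto
  obtain f where f: "\<forall>v. f v \<in> carrier R" "f v = z" "f (last (v # p)) = \<zero>"
    "\<forall>s t. {s, t} \<in> set (walk_edges (v # p)) \<longrightarrow> f s \<ominus> f t \<in> \<alpha> {s, t}"
    using "1.IH"[OF _ _ _ yz(2)] "1.prems"(2,3) by auto
  define g where "g = f(u := x)"
  have gf: "g s = f s" if "s \<in> set (v # p)" for s
    using that "1.prems"(2) by (auto simp: g_def)
  have uv: "x \<ominus> z \<in> \<alpha> {u, v}"
  proof -
    have "x \<ominus> z = y" unfolding yz(3) by (simp add: a_minus_def a_assoc r_neg)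
    then show ?thesis using yz(1) by simp
  qed
  have "g s \<ominus> g t \<in> \<alpha> {s, t}" if st: "{s, t} \<in> set (walk_edges (u # v # p))" for s t
  proof (cases "{s, t} \<in> set (walk_edges (v # p))")
    case True
    then have "s \<in> set (v # p)" "t \<in> set (v # p)"
      using walk_edge_subset by fastforce+
    with True show ?thesis
      using f(4) gf by auto
  next
    case False
    then have "{s, t} = {u, v}"
      using st by simp
    moreover have "g u = x" "g v = z"
      using f(2) gf by (auto simp: g_def)
    moreover have "z \<ominus> x \<in> \<alpha> {u, v}"
      using ideal_minus_commute[OF id _ _ uv] yz(3) by simp
    ultimately show ?thesis
      using uv by (auto simp: doubleton_eq_iff insert_commute)
  qed
  moreover have "\<forall>v. g v \<in> carrier R"
    using f(1) yz(3) by (simp add: g_def)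
  moreover have "g (last (u # v # p)) = \<zero>"
    using gf[of "last (v # p)"] f(3) by simp
  ultimately show ?case
    by (intro exI[of _ g]) (simp add: g_def)
next
  case ("2_2" v)
  then show ?case
    by (intro exI[of _ "\<lambda>_. \<zero>"]) auto
qed auto

section \<open>Combining splines, and the tree case\<close>

lemma constant_spline:
  assumes "edge_labeling R E \<alpha>" "c \<in> carrier R"
  shows "spline R V E \<alpha> (\<lambda>_. c)"
proof -
  have "\<zero> \<in> \<alpha> e" if "e \<in> E" for e
    using that assms(1) additive_subgroup.zero_closed ideal.axioms(1)
    unfolding edge_labeling_def by blast
  then show ?thesis
    using assms(2) by (auto simp: spline_def a_minus_def r_neg)
qed

lemma spline_add:
  assumes "edge_labeling R E \<alpha>" "simple_graph V E" "spline R V E \<alpha> \<rho>" "spline R V E \<alpha> \<sigma>"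
  shows "spline R V E \<alpha> (\<lambda>v. \<rho> v \<oplus> \<sigma> v)"
  unfolding spline_def
proof (intro conjI allI impI)
  show "(\<lambda>v. \<rho> v \<oplus> \<sigma> v) \<in> V \<rightarrow> carrier R"
    using assms(3,4) by (auto simp: spline_def)
  fix u v
  assume e: "{u, v} \<in> E"
  have c: "\<rho> u \<in> carrier R" "\<rho> v \<in> carrier R" "\<sigma> u \<in> carrier R" "\<sigma> v \<in> carrier R"
    using simple_graph_edgeD[OF assms(2) e] assms(3,4) by (auto simp: spline_def)
  have "(\<rho> u \<oplus> \<sigma> u) \<ominus> (\<rho> v \<oplus> \<sigma> v) = (\<rho> u \<ominus> \<rho> v) \<oplus> (\<sigma> u \<ominus> \<sigma> v)"
    using c by algebra
  moreover have "ideal (\<alpha> {u, v}) R"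
    using assms(1) e by (simp add: edge_labeling_def)
  then interpret I: ideal "\<alpha> {u, v}" R .
  have "(\<rho> u \<ominus> \<rho> v) \<oplus> (\<sigma> u \<ominus> \<sigma> v) \<in> \<alpha> {u, v}"
    using e assms(3,4) by (intro I.a_closed) (auto simp: spline_def)
  ultimately show "(\<rho> u \<oplus> \<sigma> u) \<ominus> (\<rho> v \<oplus> \<sigma> v) \<in> \<alpha> {u, v}"
    by simp
qed

text \<open>This function is zero on the side of \<open>v\<close> and \<open>y\<close> elsewhere.
  Every edge other than the bridge stays on one side, so the only jump is across the bridge, where
  it is \<open>y\<close> or its negative.\<close>

lemma bridge_spline:
  assumes "edge_labeling R E \<alpha>" "{u, v} \<in> E" "y \<in> \<alpha> {u, v}"
    and bridge: "(v, u) \<notin> {(a, b). {a, b} \<in> E - {{u, v}}}\<^sup>*"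
  shows "spline R V E \<alpha> (\<lambda>t. if (v, t) \<in> {(a, b). {a, b} \<in> E - {{u, v}}}\<^sup>* then \<zero> else y)"
    (is "spline R V E \<alpha> ?\<rho>")
  unfolding spline_def
proof (intro conjI allI impI)
  let ?r = "{(a, b). {a, b} \<in> E - {{u, v}}}"
  have id: "ideal (\<alpha> e) R" if "e \<in> E" for e
    using that assms(1) by (simp add: edge_labeling_def)
  have yc: "y \<in> carrier R"
    using ideal.Icarr[OF id[OF assms(2)] assms(3)] .
  then show "?\<rho> \<in> V \<rightarrow> carrier R"
    by auto
  fix s t
  assume e: "{s, t} \<in> E"
  show "?\<rho> s \<ominus> ?\<rho> t \<in> \<alpha> {s, t}"
  proof (cases "{s, t} = {u, v}")
    case False
    then have "(s, t) \<in> ?r" "(t, s) \<in> ?r"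
      using e by (auto simp: insert_commute)
    then have "(v, s) \<in> ?r\<^sup>* \<longleftrightarrow> (v, t) \<in> ?r\<^sup>*"
      by (meson rtrancl.rtrancl_into_rtrancl)
    then have "?\<rho> s = ?\<rho> t"
      by simp
    then have "?\<rho> s \<ominus> ?\<rho> t = \<zero>"
      using yc by (simp add: a_minus_def r_neg)
    then show ?thesis
      using additive_subgroup.zero_closed[OF ideal.axioms(1)[OF id[OF e]]] by simp
  next
    case True
    have "?\<rho> v = \<zero>" "?\<rho> u = y"
      using bridge by auto
    moreover have "y \<ominus> \<zero> \<in> \<alpha> {u, v}"
      using assms(3) yc by (simp add: a_minus_def)
    moreover from this have "\<zero> \<ominus> y \<in> \<alpha> {u, v}"
      using ideal_minus_commute[OF id[OF assms(2)]] yc by blast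
    ultimately show ?thesis
      using True by (auto simp: doubleton_eq_iff insert_commute simp del: if_split)
  qed
qed

text \<open>A spline with the right difference along the tail exists by induction. Adding a step
  function across the first edge corrects the difference there and leaves the tail's difference
  alone.\<close>

lemma tree_path_spline:
  assumes "simple_graph V E" "\<nexists>c. graph_cycle V E c" "edge_labeling R E \<alpha>"
    and "p \<noteq> []" "distinct p" "set (walk_edges p) \<subseteq> E" "set p \<subseteq> V" "x \<in> path_label R \<alpha> p"
  shows "\<exists>\<rho>. spline R V E \<alpha> \<rho> \<and> \<rho> (hd p) \<ominus> \<rho> (last p) = x"
  using assms(4-)
proof (induction p arbitrary: x rule: walk_edges.induct)
  case (1 u v p)
  let ?r = "{(a, b). {a, b} \<in> E - {{u, v}}}"
  obtain y z where yz: "y \<in> \<alpha> {u, v}" "z \<in> path_label R \<alpha> (v # p)" "x = y \<oplus> z"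
    using "1.prems"(5) by (auto simp: set_add_def')
  have e: "{u, v} \<in> E"
    using "1.prems"(3) by simp
  have id: "ideal (\<alpha> {u, v}) R"
    using assms(3) e by (simp add: edge_labeling_def)
  then have y: "y \<in> carrier R"
    using yz(1) ideal.Icarr by metis
  obtain \<rho> where \<rho>: "spline R V E \<alpha> \<rho>" "\<rho> v \<ominus> \<rho> (last (v # p)) = z"
    using "1.IH"[OF _ _ _ _ yz(2)] "1.prems" by auto
  let ?w = "last (v # p)"
  have "?w \<in> V" "u \<in> V" "v \<in> V"
    using "1.prems"(4) last_in_set[of "v # p"] by auto
  then have c: "\<rho> ?w \<in> carrier R" "\<rho> u \<in> carrier R" "\<rho> v \<in> carrier R"
    using \<rho>(1) by (auto simp: spline_def)
  \<comment> \<open>The defect at the first edge: the required summand minus the jump that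
    \<open>\<rho>\<close> already makes. Both lie in the label, hence so does
    \<open>y'\<close>.\<close>
  define y' where "y' = y \<ominus> (\<rho> u \<ominus> \<rho> v)"
  interpret I: ideal "\<alpha> {u, v}" R by fact
  have y': "y' \<in> \<alpha> {u, v}"
    using \<rho>(1) e yz(1) unfolding y'_def a_minus_def[of R y] spline_def
    by (intro I.a_closed I.a_inv_closed) auto
  define \<sigma> where "\<sigma> t = (if (v, t) \<in> ?r\<^sup>* then \<zero> else y')" for t
  have bridge: "(v, u) \<notin> ?r\<^sup>*"
    using acyclic_edge_is_bridge[OF assms(1,2) e] .
  have \<sigma>: "spline R V E \<alpha> \<sigma>"
    using bridge_spline[OF assms(3) e y' bridge] unfolding \<sigma>_def[abs_def] .
  \<comment> \<open>The tail never uses the bridge, so its end lies on the side of \<open>v\<close>,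
    where the correction vanishes.\<close>
  have "{u, v} \<notin> set (walk_edges (v # p))"
    using walk_edge_subset "1.prems"(2) by fastforce
  then have "(v, ?w) \<in> ?r\<^sup>*"
    using walk_imp_rtrancl[of "v # p" "E - {{u, v}}"] "1.prems"(3)
    by (simp add: subset_Diff_insert)
  then have "\<sigma> u = y'" "\<sigma> ?w = \<zero>"
    using bridge by (auto simp: \<sigma>_def)
  then have "(\<rho> u \<oplus> \<sigma> u) \<ominus> (\<rho> ?w \<oplus> \<sigma> ?w) = (\<rho> u \<oplus> (y \<ominus> (\<rho> u \<ominus> \<rho> v))) \<ominus> \<rho> ?w"
    using c by (simp add: y'_def)
  also have "\<dots> = y \<oplus> (\<rho> v \<ominus> \<rho> ?w)"
    using c y by algebra
  finally have "(\<rho> u \<oplus> \<sigma> u) \<ominus> (\<rho> ?w \<oplus> \<sigma> ?w) = x"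
    using yz(3) \<rho>(2) by simp
  then show ?case
    using spline_add[OF assms(3,1) \<rho>(1) \<sigma>] by auto
next
  case ("2_2" v)
  then show ?case
    using constant_spline[OF assms(3) zero_closed] by (intro exI[of _ "\<lambda>_. \<zero>"]) (auto simp: a_minus_def)
qed auto

lemma tree_universal_difference_property:
  assumes "simple_graph V E" "is_tree V E" "edge_labeling R E \<alpha>"
  shows "universal_difference_property R V E \<alpha>"
  unfolding universal_difference_property_def
proof (intro ballI)
  fix u w x
  assume "u \<in> V" "w \<in> V"
    and x: "x \<in> carrier R \<inter> (\<Inter>p\<in>{p. graph_path V E u p w}. path_label R \<alpha> p)"
  then obtain p where p: "graph_path V E u p w"
    using assms(2) unfolding is_tree_def graph_connected_def by blast
  then have "x \<in> path_label R \<alpha> p"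
    using x by blast
  then show "\<exists>\<rho>. spline R V E \<alpha> \<rho> \<and> \<rho> u \<ominus> \<rho> w = x"
    using tree_path_spline[of V E \<alpha> p x] assms p by (auto simp: is_tree_def graph_path_def)
qed

section \<open>Gluing along the two arcs of a cycle\<close>

lemma cycle_universal_difference_property:
  assumes "is_cycle V E" "edge_labeling R E \<alpha>"
  shows "universal_difference_property R V E \<alpha>"
  unfolding universal_difference_property_def
proof (intro ballI)
  fix u w x
  assume uw: "u \<in> V" "w \<in> V"
    and x: "x \<in> carrier R \<inter> (\<Inter>p\<in>{p. graph_path V E u p w}. path_label R \<alpha> p)"
  show "\<exists>\<rho>. spline R V E \<alpha> \<rho> \<and> \<rho> u \<ominus> \<rho> w = x"
  proof (cases "u = w")
    case True
    \<comment> \<open>The one-vertex path has label zero, which forces \<open>x\<close> to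
      vanish.\<close>
    have "graph_path V E u [u] w"
      using True uw by (simp add: graph_path_def)
    then have "x = \<zero>"
      using x by fastforce
    then show ?thesis
      using True constant_spline[OF assms(2) zero_closed]
      by (intro exI[of _ "\<lambda>_. \<zero>"]) (simp add: a_minus_def)
  next
    case False
    obtain c where c: "graph_cycle V E c" "set c = V" "cycle_edges c = E"
      using assms(1) unfolding is_cycle_def by blast
    obtain q where q: "graph_cycle V E (u # q)" "set (u # q) = set c" "cycle_edges (u # q) = cycle_edges c"
      using graph_cycle_rotate[OF c(1)] uw c(2) by metis
    then have "w \<in> set q"
      using uw c False by auto
    then obtain A B where AB: "q = A @ w # B"
      by (auto simp: in_set_conv_decomp)
    let ?P = "u # A @ [w]" and ?Q = "u # rev B @ [w]"
    have E: "E = set (walk_edges ?P) \<union> set (walk_edges ?Q)"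
      using q(3) c(3) unfolding AB by (simp only: cycle_edges_split)
    have V: "V = set ?P \<union> set ?Q"
      using q(2) c(2) AB by auto
    have dist: "distinct ?P" "distinct ?Q" "set A \<inter> set B = {}"
      using q(1) by (auto simp: graph_cycle_def AB)
    have "graph_path V E u ?P w" "graph_path V E u ?Q w"
      using dist E V by (auto simp: graph_path_def)
    then have "x \<in> path_label R \<alpha> ?P" "x \<in> path_label R \<alpha> ?Q"
      using x by blast+
    moreover have "ideal (\<alpha> e) R" if "e \<in> set (walk_edges ?P) \<union> set (walk_edges ?Q)" for e
      using that assms(2) E by (simp add: edge_labeling_def)
    ultimately obtain f g where f: "\<forall>v. f v \<in> carrier R" "f u = x" "f w = \<zero>"
        "\<forall>s t. {s, t} \<in> set (walk_edges ?P) \<longrightarrow> f s \<ominus> f t \<in> \<alpha> {s, t}"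
      and g: "\<forall>v. g v \<in> carrier R" "g u = x" "g w = \<zero>"
        "\<forall>s t. {s, t} \<in> set (walk_edges ?Q) \<longrightarrow> g s \<ominus> g t \<in> \<alpha> {s, t}"
      using spline_along_path[of ?P \<alpha> x] spline_along_path[of ?Q \<alpha> x] dist by auto
    define \<rho> where "\<rho> v = (if v \<in> set ?P then f v else g v)" for v
    \<comment> \<open>The arcs share only \<open>u\<close> and \<open>w\<close>, where both
      functions take the values \<open>x\<close> and zero; elsewhere on \<open>?Q\<close> the
      definition selects \<open>g\<close>.\<close>
    have \<rho>g: "\<rho> v = g v" if "v \<in> set ?Q" for v
      using that f(2,3) g(2,3) dist(3) by (auto simp: \<rho>_def)
    have "spline R V E \<alpha> \<rho>"
      unfolding spline_def
    proof (intro conjI allI impI)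
      show "\<rho> \<in> V \<rightarrow> carrier R"
        using f(1) g(1) by (simp add: \<rho>_def)
      fix s t
      assume "{s, t} \<in> E"
      then consider "{s, t} \<in> set (walk_edges ?P)" | "{s, t} \<in> set (walk_edges ?Q)"
        using E by blast
      then show "\<rho> s \<ominus> \<rho> t \<in> \<alpha> {s, t}"
      proof cases
        case 1
        then have "s \<in> set ?P" "t \<in> set ?P"
          using walk_edge_subset by (metis insert_subset)+
        then show ?thesis
          using f(4) 1 by (simp add: \<rho>_def)
      next
        case 2
        then have "s \<in> set ?Q" "t \<in> set ?Q"
          using walk_edge_subset by (metis insert_subset)+
        then show ?thesis
          using g(4) 2 by (simp only: \<rho>g)
      qed
    qed
    moreover have "\<rho> u \<ominus> \<rho> w = x"
      using f(2,3) x by (simp add: \<rho>_def a_minus_def)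
    ultimately show ?thesis
      by blast
  qed
qed

section \<open>A counterexample on a cycle with a pendant edge\<close>

text \<open>Since \<open>J\<close> and \<open>K\<close> meet in zero, I + (J \<inter> K) is just
  \<open>I\<close>. So \<open>x\<close> witnesses that this ideal is strictly smaller than (I + J)
  \<inter> (I + K).\<close>

lemma pendant_edge_not_universal_difference_property:
  assumes "graph_cycle V E (a # q)" "d \<in> V" "d \<notin> set (a # q)" "{d, a} \<in> E"
    and ideals: "ideal I R" "ideal J R" "ideal K R"
    and x: "x \<in> I <+>\<^bsub>R\<^esub> J" "x \<in> I <+>\<^bsub>R\<^esub> K" "x \<notin> I" and JK: "J \<inter> K = {\<zero>}"
  shows "\<exists>\<alpha>. edge_labeling R E \<alpha> \<and> \<not> universal_difference_property R V E \<alpha>"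
proof -
  \<comment> \<open>The two neighbours \<open>b\<close> and \<open>z\<close> of \<open>a\<close> are
    distinct because a cycle has at least three vertices; \<open>r\<close> may be empty, as in a
    triangle.\<close>
  obtain b r z where q: "q = b # r @ [z]"
    using assms(1) by (cases q; cases "tl q" rule: rev_cases) (auto simp: graph_cycle_def)
  have dist: "distinct (a # b # r @ [z])" "d \<notin> set (a # b # r @ [z])"
    using assms(1,3) by (auto simp: graph_cycle_def q)
  have ce: "cycle_edges (a # q) = {{a, b}, {a, z}} \<union> set (walk_edges (b # r @ [z]))"
    using walk_edges_append[of "b # r" z "[a]"] by (auto simp: cycle_edges_def q insert_commute)
  have cE: "cycle_edges (a # q) \<subseteq> E" "set (a # q) \<subseteq> V"
    using assms(1) by (auto simp: graph_cycle_def)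
  \<comment> \<open>Zero labels force a spline to be constant from \<open>b\<close> to
    \<open>z\<close>, while the label \<open>carrier R\<close> imposes no condition on splines and
    makes the label of any path through that edge the whole ring.\<close>
  define \<alpha> where "\<alpha> e = (if e = {d, a} then I else if e = {a, b} then J else if e = {a, z} then K
    else if e \<in> set (walk_edges (b # r @ [z])) then {\<zero>} else carrier R)" for e
  have lab: "ideal (\<alpha> e) R" for e
    using ideals zeroideal oneideal by (simp add: \<alpha>_def)
  have \<alpha>da: "\<alpha> {d, a} = I" and \<alpha>ab: "\<alpha> {a, b} = J" and \<alpha>az: "\<alpha> {a, z} = K"
    using dist by (auto simp: \<alpha>_def doubleton_eq_iff)
  have xc: "x \<in> carrier R"
    using x(1) ideals(1,2)[THEN ideal.Icarr] by (auto simp: set_add_def')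
  have sum_right: "y \<in> A <+>\<^bsub>R\<^esub> B" if "ideal A R" "y \<in> B" "y \<in> carrier R" for y A B
    using additive_subgroup.zero_closed[OF ideal.axioms(1)[OF that(1)]] that(2,3)
    by (force simp: set_add_def')
  have sum_left: "y \<in> A <+>\<^bsub>R\<^esub> B" if "\<zero> \<in> B" "y \<in> A" "y \<in> carrier R" for y A B
    using that by (force simp: set_add_def')
  \<comment> \<open>Two edges of the path decide. If the first is not the edge from \<open>d\<close>
    to \<open>a\<close>, its label is the whole ring. Otherwise the next edge leaves
    \<open>a\<close> with label \<open>J\<close>, \<open>K\<close> or the whole ring, and adding
    \<open>I\<close> captures \<open>x\<close> in each case. The remaining labels contain zero, so
    they only enlarge the sum.\<close>
  have in_label: "x \<in> path_label R \<alpha> p" if p: "graph_path V E d p b" for p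
  proof -
    have "d \<noteq> b" "a \<noteq> b"
      using dist by auto
    obtain s p' where p': "p = d # s # p'"
      using p \<open>d \<noteq> b\<close> by (cases p rule: walk_edges.cases) (auto simp: graph_path_def)
    have zero: "\<zero> \<in> path_label R \<alpha> (t # l)" for t l
      by (rule zero_in_path_label) (simp_all add: lab)
    show ?thesis
    proof (cases "s = a")
      case False
      have "{d, s} \<notin> set (walk_edges (b # r @ [z]))"
        using walk_edge_subset[of "{d, s}" "b # r @ [z]"] dist(2) by auto
      then have "\<alpha> {d, s} = carrier R"
        using dist False by (auto simp: \<alpha>_def doubleton_eq_iff)
      then show ?thesis
        using sum_left[OF zero _ xc] xc by (simp add: p')
    next
      case True
      then obtain t l where l: "p' = t # l"
        using p \<open>a \<noteq> b\<close> by (cases p') (auto simp: graph_path_def p')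
      have "t \<noteq> d" "t \<noteq> a"
        using p True by (auto simp: graph_path_def p' l)
      then consider "t = b" | "t = z" | "\<alpha> {a, t} = carrier R"
      proof -
        assume "t \<noteq> d" "t \<noteq> a"
        have "{a, t} \<notin> set (walk_edges (b # r @ [z]))"
          using walk_edge_subset[of "{a, t}" "b # r @ [z]"] dist(1) by auto
        then have "\<alpha> {a, t} = carrier R" if "t \<noteq> b" "t \<noteq> z"
          using that \<open>t \<noteq> d\<close> \<open>t \<noteq> a\<close> by (auto simp: \<alpha>_def doubleton_eq_iff)
        then show thesis
          using that by blast
      qed
      then have "x \<in> I <+>\<^bsub>R\<^esub> \<alpha> {a, t}"
      proof cases
        case 3
        then show ?thesis using sum_right[OF ideals(1) _ xc] xc by simp
      qed (use x \<alpha>ab \<alpha>az in auto)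
      moreover have "\<alpha> {a, t} \<subseteq> \<alpha> {a, t} <+>\<^bsub>R\<^esub> path_label R \<alpha> (t # l)"
        using sum_left[OF zero] ideal.Icarr[OF lab] by blast
      ultimately have "x \<in> I <+>\<^bsub>R\<^esub> (\<alpha> {a, t} <+>\<^bsub>R\<^esub> path_label R \<alpha> (t # l))"
        unfolding set_add_def'[of R I] by blast
      then show ?thesis
        by (simp add: p' l True \<alpha>da)
    qed
  qed
  have "\<not> (spline R V E \<alpha> \<rho> \<and> \<rho> d \<ominus> \<rho> b = x)" for \<rho>
  proof
    assume \<rho>: "spline R V E \<alpha> \<rho> \<and> \<rho> d \<ominus> \<rho> b = x"
    have \<rho>c: "\<rho> v \<in> carrier R" if "v \<in> V" for v
      using that \<rho> by (auto simp: spline_def)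
    have \<rho>e: "\<rho> s \<ominus> \<rho> t \<in> \<alpha> {s, t}" if "{s, t} \<in> E" for s t
      using that \<rho> by (auto simp: spline_def)
    \<comment> \<open>Stated for every list using only edges of the zero-labelled arc, so that the
      induction can pass to tails.\<close>
    have const: "\<rho> (hd l) = \<rho> (last l)"
      if "l \<noteq> []" "set (walk_edges l) \<subseteq> set (walk_edges (b # r @ [z]))" for l
      using that
    proof (induction l rule: walk_edges.induct)
      case (1 s t l)
      then have st: "{s, t} \<in> set (walk_edges (b # r @ [z]))" and IH: "\<rho> t = \<rho> (last (t # l))"
        by auto
      have "{s, t} \<subseteq> set (b # r @ [z])"
        using walk_edge_subset[OF st] .
      then have "a \<notin> {s, t}" "s \<in> V" "t \<in> V"
        using dist cE by (auto simp: q)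
      then have "\<alpha> {s, t} = {\<zero>}"
        using st by (auto simp: \<alpha>_def)
      then have "\<rho> s \<ominus> \<rho> t = \<zero>"
        using \<rho>e[of s t] st cE(1) ce by auto
      then have "\<rho> s = \<rho> t"
        using \<rho>c \<open>s \<in> V\<close> \<open>t \<in> V\<close> by (metis a_inv_closed a_minus_def minus_equality minus_minus)
      then show ?case using IH by simp
    qed auto
    have "\<rho> b = \<rho> z"
      using const[of "b # r @ [z]"] by simp
    moreover have "\<rho> a \<ominus> \<rho> b \<in> J" "\<rho> a \<ominus> \<rho> z \<in> K"
      using \<rho>e[of a b] \<rho>e[of a z] ce cE(1) \<alpha>ab \<alpha>az by auto
    \<comment> \<open>As \<open>b\<close> and \<open>z\<close> have the same value, the difference
      lies in both \<open>J\<close> and \<open>K\<close>. Thus the difference between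
      \<open>d\<close> and \<open>b\<close> equals that between \<open>d\<close> and
      \<open>a\<close>, which lies in \<open>I\<close>.\<close>
    ultimately have "\<rho> a \<ominus> \<rho> b = \<zero>"
      using JK by auto
    moreover have "a \<in> V" "b \<in> V"
      using cE(2) by (auto simp: q)
    ultimately have "\<rho> a = \<rho> b"
      using \<rho>c by (metis a_inv_closed a_minus_def minus_equality minus_minus)
    then have "\<rho> d \<ominus> \<rho> b \<in> I"
      using \<rho>e[OF assms(4)] \<alpha>da by simp
    then show False
      using \<rho> x(3) by simp
  qed
  moreover have "b \<in> V"
    using cE(2) by (auto simp: q)
  ultimately have "\<not> universal_difference_property R V E \<alpha>"
    using in_label xc assms(2) unfolding universal_difference_property_def by blast
  then show ?thesis
    using lab by (auto simp: edge_labeling_def)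
qed

end

text \<open>The ring \<open>F\<^sub>2[X, Y] / (X, Y)\<^sup>2\<close>, with the triple \<open>(a, b, c)\<close> standing for
  \<open>a + bX + cY\<close>, and its ideals generated by \<open>X + Y\<close>, \<open>X\<close> and \<open>Y\<close>.\<close>

lemma exists_nondistributive_ideals:
  assumes "infinite (UNIV :: 'r set)"
  shows "\<exists>(R :: 'r ring) I J K x. cring R \<and> ideal I R \<and> ideal J R \<and> ideal K R \<and>
    x \<in> I <+>\<^bsub>R\<^esub> J \<and> x \<in> I <+>\<^bsub>R\<^esub> K \<and> x \<notin> I \<and> J \<inter> K = {\<zero>\<^bsub>R\<^esub>}"
proof -
  \<comment> \<open>Infinity of \<open>'r\<close> gives room for the eight triples; the ring
    structure is carried over to the range of \<open>f\<close>.\<close>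
  obtain f :: "bool \<times> bool \<times> bool \<Rightarrow> 'r" where f: "inj f"
    using assms finite_imp_inj_to_nat_seg[of "UNIV :: (bool \<times> bool \<times> bool) set"]
      infinite_countable_subset[OF assms] by (metis inj_compose finite)
  \<comment> \<open>Inequality of Booleans is addition modulo 2 and conjunction is multiplication.
    Products of two terms from X and Y are dropped.\<close>
  define R :: "'r ring" where "R = \<lparr>carrier = range f,
    mult = (\<lambda>x y. case (inv_into UNIV f x, inv_into UNIV f y) of ((a, b, c), (a', b', c')) \<Rightarrow>
      f (a \<and> a', (a \<and> b') \<noteq> (b \<and> a'), (a \<and> c') \<noteq> (c \<and> a'))),
    one = f (True, False, False), zero = f (False, False, False),
    add = (\<lambda>x y. case (inv_into UNIV f x, inv_into UNIV f y) of ((a, b, c), (a', b', c')) \<Rightarrow>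
      f (a \<noteq> a', b \<noteq> b', c \<noteq> c'))\<rparr>"
  have [simp]: "inv_into UNIV f (f t) = t" "f t = f t' \<longleftrightarrow> t = t'" for t t'
    using f by (auto simp: inj_eq)
  have R [simp]: "carrier R = range f" "\<one>\<^bsub>R\<^esub> = f (True, False, False)"
    "\<zero>\<^bsub>R\<^esub> = f (False, False, False)"
    "f (a, b, c) \<otimes>\<^bsub>R\<^esub> f (a', b', c') = f (a \<and> a', (a \<and> b') \<noteq> (b \<and> a'), (a \<and> c') \<noteq> (c \<and> a'))"
    "f (a, b, c) \<oplus>\<^bsub>R\<^esub> f (a', b', c') = f (a \<noteq> a', b \<noteq> b', c \<noteq> c')" for a b c a' b' c'
    by (simp_all add: R_def)
  have cring: "cring R"
  proof (intro cringI abelian_groupI comm_monoidI)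
    show "\<exists>y\<in>carrier R. y \<oplus>\<^bsub>R\<^esub> x = \<zero>\<^bsub>R\<^esub>" if "x \<in> carrier R" for x
      using that by (intro bexI[of _ x]) auto
  qed auto
  then interpret cring R .
  \<comment> \<open>Multiplying bX + cY by any element only scales it by that element's constant
    term, 0 or 1, so these two elements absorb products.\<close>
  have ideal: "ideal {f (False, False, False), f (False, b, c)} R" for b c
  proof (rule idealI)
    show "subgroup {f (False, False, False), f (False, b, c)} (add_monoid R)"
    proof (rule add.subgroupI)
      \<comment> \<open>Characteristic 2: every element is its own negative.\<close>
      have "\<ominus>\<^bsub>R\<^esub> f t = f t" for t
        by (rule minus_equality) (cases t; simp)+
      then show "\<ominus>\<^bsub>R\<^esub> x \<in> {f (False, False, False), f (False, b, c)}"
        if "x \<in> {f (False, False, False), f (False, b, c)}" for x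
        using that by auto
    qed auto
  qed (auto simp: ring_axioms)
  let ?I = "{f (False, False, False), f (False, True, True)}"
    and ?J = "{f (False, False, False), f (False, True, False)}"
    and ?K = "{f (False, False, False), f (False, False, True)}"
  \<comment> \<open>The witness is X: it lies in \<open>?J\<close>, and X = (X + Y) + Y puts it in
    the sum of \<open>?I\<close> and \<open>?K\<close>.\<close>
  have "f (False, True, False) \<in> ?I <+>\<^bsub>R\<^esub> ?J" "f (False, True, False) \<in> ?I <+>\<^bsub>R\<^esub> ?K"
    "f (False, True, False) \<notin> ?I" "?J \<inter> ?K = {\<zero>\<^bsub>R\<^esub>}"
    by (auto simp: set_add_def')
  with cring ideal show ?thesis
    by (intro exI[of _ R] exI[of _ ?I] exI[of _ ?J] exI[of _ ?K] exI[of _ "f (False, True, False)"])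
      (simp only: simp_thms)
qed

theorem theorem5p3:
  fixes V :: "'v set" and E :: "'v set set"
  assumes "infinite (UNIV :: 'r set)"
    and "simple_graph V E"
    and "graph_connected V E"
  shows "(\<forall>(R :: 'r ring) (\<alpha> :: 'v set \<Rightarrow> 'r set).
            cring R \<longrightarrow> edge_labeling R E \<alpha> \<longrightarrow> universal_difference_property R V E \<alpha>)
         \<longleftrightarrow> is_tree V E \<or> is_cycle V E"
proof
  assume udp: "\<forall>(R :: 'r ring) (\<alpha> :: 'v set \<Rightarrow> 'r set).
    cring R \<longrightarrow> edge_labeling R E \<alpha> \<longrightarrow> universal_difference_property R V E \<alpha>"
  show "is_tree V E \<or> is_cycle V E"
  proof (rule ccontr)
    assume neg: "\<not> (is_tree V E \<or> is_cycle V E)"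
    then obtain c where "graph_cycle V E c"
      using assms(3) by (auto simp: is_tree_def)
    then obtain a q d where aqd: "graph_cycle V E (a # q)" "d \<in> V" "d \<notin> set (a # q)" "{d, a} \<in> E"
      using not_cycle_imp_pendant_edge[OF assms(2,3)] neg by metis
    obtain R :: "'r ring" and I J K x where R: "cring R"
      and "ideal I R" "ideal J R" "ideal K R" "x \<in> I <+>\<^bsub>R\<^esub> J" "x \<in> I <+>\<^bsub>R\<^esub> K" "x \<notin> I"
        "J \<inter> K = {\<zero>\<^bsub>R\<^esub>}"
      using exists_nondistributive_ideals[OF assms(1)] by blast
    then show False
      using cring.pendant_edge_not_universal_difference_property[OF R aqd] udp by blast
  qed
next
  assume "is_tree V E \<or> is_cycle V E"
  then show "\<forall>(R :: 'r ring) (\<alpha> :: 'v set \<Rightarrow> 'r set).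
    cring R \<longrightarrow> edge_labeling R E \<alpha> \<longrightarrow> universal_difference_property R V E \<alpha>"
    using cring.tree_universal_difference_property[OF _ assms(2)]
      cring.cycle_universal_difference_property by blast
qed

end
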